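(* Let $G$ be a finite directed graph. The sets declared as strong components by Algorithm C (described in the context) are exactly the strong components of $G$.
   Context: Loops and parallel arcs are allowed; each arc goes from its tail to its tip. Two vertices are mutually reachable if each is reachable from the other by a directed path; the equivalence classes are the strong components. A depth-first exploration proceeds as follows. Initially all vertices are unvisited, all arcs untraversed, and the current vertex is null. Repeat the applicable case until all vertices are visited and all arcs are traversed: (i) The current vertex is null and some vertex is unvisited: choose any unvisited vertex $v$, make it current and visit it; $v$ is the root of a new search. (ii) The current vertex $v$ has an untraversed exiting arc: choose any such arc $a$, from $v$ to $w$, and advance on it. If $w$ is already visited, immediately retreat on $a$; in this case $a$ is a non-tree arc and this advance–retreat pair is its traversal. Otherwise $a$ becomes a tree arc, $w$ becomes current, and $w$ is visited. (iii) The current vertex $v$ has no untraversed exiting arc: if $v$ is the root of the current search, the current vertex becomes null; otherwise retreat on the tree arc entering $v$, say from $u$, and make $u$ current. The visit of $v$ is its previsit. The step (iii) at which $v$ is current with no untraversed exiting arc is its postvisit. Algorithm C performs one depth-first exploration while maintaining a collection of disjoint vertex sets, each with a designated leader, and a stack $L$ of leaders (initially empty). - Previsit of $v$: set $v.\mathit{pre}$ to the next integer $1,2,\dots$; create the set $\{v\}$ with leader $v$; push $v$ onto $L$. - Traversal of a non-tree arc with tip $y$: while the top vertex of $L$ has $\mathit{pre}$ value greater than $y.\mathit{pre}$, pop the top vertex of $L$ and unite its set with the set of the new top vertex of $L$; that new top vertex becomes the leader of the united set. - Postvisit of $v$: if $v$ is on top of $L$, pop $v$ from $L$, set $w.\mathit{pre}\gets\infty$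 for every vertex $w$ in the set with leader $v$, and declare this set a strong component. Here $\infty$ exceeds every integer.
   Formalization: The exploration runs until no case applies (current vertex null, no vertex unvisited), not merely until all vertices are visited and all arcs traversed; otherwise the last postvisits would be skipped, e.g. a one-vertex graph would declare nothing. *)

theory Defs
  imports "Graph_Theory.Digraph" "HOL-Library.Extended_Nat"
begin

definition strong_components :: "('v, 'a) pre_digraph \<Rightarrow> 'v set set" where
  "strong_components G = verts G // {(u, v). u \<rightarrow>\<^sup>*\<^bsub>G\<^esub> v \<and> v \<rightarrow>\<^sup>*\<^bsub>G\<^esub> u}"

text \<open>
  The collection of disjoint sets with leaders is stored as \<open>members\<close>: \<open>members s l\<close> is the
  set whose leader is \<open>l\<close>. All sets in the collection are nonempty, so \<open>members s l = {}\<close>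
  encodes that \<open>l\<close> is not the leader of any set. The head of the list \<open>leaders\<close> is the top of
  the stack \<open>L\<close>. The value \<open>pre s v\<close> is only meaningful for \<open>v \<in> visited s\<close>, and
  \<open>clock s\<close> is the last number handed out. An arc is put into \<open>traversed\<close> when the search
  advances on it.
\<close>

record ('v, 'a) state =
  visited :: "'v set"
  traversed :: "'a set"
  tree_arcs :: "'a set"
  current :: "'v option"
  search_root :: "'v option"
  clock :: nat
  pre :: "'v \<Rightarrow> enat"
  members :: "'v \<Rightarrow> 'v set"
  leaders :: "'v list"
  declared :: "'v set set"

definition init :: "('v, 'a) state" where
  "init = \<lparr>visited = {}, traversed = {}, tree_arcs = {}, current = None, search_root = None,
     clock = 0, pre = (\<lambda>_. 0), members = (\<lambda>_. {}), leaders = [], declared = {}\<rparr>"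

definition previsit :: "'v \<Rightarrow> ('v, 'a) state \<Rightarrow> ('v, 'a) state" where
  "previsit v s = s\<lparr>
     visited := insert v (visited s),
     clock := Suc (clock s),
     pre := (pre s)(v := enat (Suc (clock s))),
     members := (members s)(v := {v}),
     leaders := v # leaders s\<rparr>"

text \<open>
  The while loop run on a non-tree arc, as a big-step relation: \<open>unite_loop k s s'\<close> says that
  the loop with bound \<open>k\<close> started in \<open>s\<close> ends in \<open>s'\<close>. No rule applies if the top of an empty
  stack would have to be inspected, or if after a pop there is no new top to unite with.
\<close>

inductive unite_loop :: "enat \<Rightarrow> ('v, 'a) state \<Rightarrow> ('v, 'a) state \<Rightarrow> bool" for k where
  exit: "unite_loop k s s"
    if "leaders s = t # ts" "\<not> pre s t > k"
| iterate: "unite_loop k s s'"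
    if "leaders s = t # u # ts" "pre s t > k"
      "unite_loop k (s\<lparr>leaders := u # ts,
         members := (members s)(u := members s u \<union> members s t, t := {})\<rparr>) s'"

definition postvisit :: "'v \<Rightarrow> ('v, 'a) state \<Rightarrow> ('v, 'a) state" where
  "postvisit v s =
     (if leaders s \<noteq> [] \<and> hd (leaders s) = v
      then s\<lparr>leaders := tl (leaders s),
             pre := (\<lambda>w. if w \<in> members s v then \<infinity> else pre s w),
             declared := insert (members s v) (declared s)\<rparr>
      else s)"

definition exits :: "('v, 'a) pre_digraph \<Rightarrow> ('v, 'a) state \<Rightarrow> 'v \<Rightarrow> 'a set" where
  "exits G s v = {a \<in> arcs G. tail G a = v \<and> a \<notin> traversed s}"

inductive step :: "('v, 'a) pre_digraph \<Rightarrow> ('v, 'a) state \<Rightarrow> ('v, 'a) state \<Rightarrow> bool" for G where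
  new_search: "step G s (previsit v (s\<lparr>current := Some v, search_root := Some v\<rparr>))"
    if "current s = None" "v \<in> verts G" "v \<notin> visited s"
| nontree_arc: "step G s s'"
    if "current s = Some v" "a \<in> exits G s v" "head G a \<in> visited s"
      "unite_loop (pre s (head G a)) (s\<lparr>traversed := insert a (traversed s)\<rparr>) s'"
| tree_arc: "step G s (previsit (head G a)
      (s\<lparr>traversed := insert a (traversed s), tree_arcs := insert a (tree_arcs s),
         current := Some (head G a)\<rparr>))"
    if "current s = Some v" "a \<in> exits G s v" "head G a \<notin> visited s"
| finish_search: "step G s ((postvisit v s)\<lparr>current := None\<rparr>)"
    if "current s = Some v" "exits G s v = {}" "search_root s = Some v"
| retreat: "step G s ((postvisit v s)\<lparr>current := Some (tail G a)\<rparr>)"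
    if "current s = Some v" "exits G s v = {}" "search_root s \<noteq> Some v"
      "a \<in> tree_arcs s" "head G a = v"

text \<open>
  A run is a maximal execution, for an arbitrary resolution of the nondeterministic choices;
  it continues for as long as some step is possible, and a run that has come to an end is
  represented by repeating its last state forever. In particular the pending postvisits are
  still performed after the last vertex has been visited and the last arc has been traversed.
\<close>

definition algorithm_C_run :: "('v, 'a) pre_digraph \<Rightarrow> (nat \<Rightarrow> ('v, 'a) state) \<Rightarrow> bool" where
  "algorithm_C_run G \<sigma> \<longleftrightarrow> \<sigma> 0 = init \<and>
     (\<forall>n. step G (\<sigma> n) (\<sigma> (Suc n)) \<or> (\<nexists>s'. step G (\<sigma> n) s') \<and> \<sigma> (Suc n) = \<sigma> n)"

definition declared_sets :: "(nat \<Rightarrow> ('v, 'a) state) \<Rightarrow> 'v set set" where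
  "declared_sets \<sigma> = (\<Union>n. declared (\<sigma> n))"

end

theory Submission
  imports Defs
begin

text \<open>
  The leaders on the stack lie on the path from the root to the current vertex, and they cut the
  visited undeclared vertices into intervals of previsit numbers, each of them strongly connected.
  Traversed arcs never lead to a set below that of their tail: if an arc from the current vertex
  leads below the top set, the path closes a cycle through all the sets in between, and the loop
  unites exactly these. When the leader on top is postvisited, every arc out of its set has
  therefore been traversed and stays in the set or enters a declared one, so the set is a strong
  component. The quantity
  2 |unvisited vertices| + |untraversed arcs| + |path| decreases with every step.
\<close>

section \<open>Lists that are strictly decreasing in a key\<close>

lemma sorted_wrt_by_key:
  fixes f :: "'b \<Rightarrow> 'c::linorder"
  assumes "sorted_wrt Q xs" "sorted_wrt (\<lambda>x y. f y < f x) xs"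
    and "x \<in> set xs" "y \<in> set xs" "f y < f x"
  shows "Q x y"
  using assms by (induction xs) (auto dest: less_asym)

lemma inj_on_of_sorted_wrt:
  fixes f :: "'b \<Rightarrow> 'c::linorder"
  assumes "sorted_wrt (\<lambda>x y. f y < f x) xs"
  shows "inj_on f (set xs)"
  using assms
proof (induction xs)
  case (Cons x xs)
  then have "f x \<notin> f ` set xs" by force
  with Cons show ?case by auto
qed simp

lemma distinct_of_sorted_wrt:
  fixes f :: "'b \<Rightarrow> 'c::linorder"
  assumes "sorted_wrt (\<lambda>x y. f y < f x) xs"
  shows "distinct xs"
  using assms by (induction xs) auto

section \<open>Strong components and vertex sets closed under arcs\<close>

context wf_digraph
begin

lemma arc_reachable: "a \<in> arcs G \<Longrightarrow> tail G a \<rightarrow>\<^sup>*\<^bsub>G\<^esub> head G a"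
  by (intro reachable_adjI) (auto simp: arcs_ends_def arc_to_ends_def)

lemma strong_components_iff:
  "C \<in> strong_components G \<longleftrightarrow>
    (\<exists>x \<in> verts G. C = {y. x \<rightarrow>\<^sup>*\<^bsub>G\<^esub> y \<and> y \<rightarrow>\<^sup>*\<^bsub>G\<^esub> x})"
  unfolding strong_components_def quotient_def by auto

lemma reachable_closed:
  assumes "x \<rightarrow>\<^sup>*\<^bsub>G\<^esub> y" "x \<in> S"
    and closed: "\<And>a. a \<in> arcs G \<Longrightarrow> tail G a \<in> S \<Longrightarrow> head G a \<in> S"
  shows "y \<in> S"
  using assms(1,2)
proof (induction rule: reachable_induct)
  case base
  then show ?case by simp
next
  case (step x y)
  then show ?case using closed by (auto simp: arcs_ends_def arc_to_ends_def)
qed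

text \<open>\<open>S\<close> and \<open>D\<close> together are closed under arcs, so all that
  \<open>x\<close> reaches lies in one of them; \<open>D\<close> alone is closed and misses
  \<open>x\<close>, so no vertex of \<open>D\<close> leads back to \<open>x\<close>. In the
  application \<open>D\<close> consists of the vertices declared earlier.\<close>

lemma strong_component_if_closed:
  assumes "x \<in> S" "S \<subseteq> verts G"
    and conn: "\<And>x y. x \<in> S \<Longrightarrow> y \<in> S \<Longrightarrow> x \<rightarrow>\<^sup>*\<^bsub>G\<^esub> y"
    and disj: "S \<inter> D = {}"
    and D: "\<And>a. a \<in> arcs G \<Longrightarrow> tail G a \<in> D \<Longrightarrow> head G a \<in> D"
    and SD: "\<And>a. a \<in> arcs G \<Longrightarrow> tail G a \<in> S \<Longrightarrow> head G a \<in> S \<union> D"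
  shows "S \<in> strong_components G"
proof -
  have "y \<in> S" if xy: "x \<rightarrow>\<^sup>*\<^bsub>G\<^esub> y" and yx: "y \<rightarrow>\<^sup>*\<^bsub>G\<^esub> x" for y
  proof -
    have "y \<in> S \<union> D"
      using reachable_closed[OF xy, of "S \<union> D"] \<open>x \<in> S\<close> D SD by blast
    moreover have "y \<notin> D"
      using reachable_closed[OF yx, of D] \<open>x \<in> S\<close> disj D by blast
    ultimately show ?thesis by blast
  qed
  then have "S = {y. x \<rightarrow>\<^sup>*\<^bsub>G\<^esub> y \<and> y \<rightarrow>\<^sup>*\<^bsub>G\<^esub> x}"
    using conn \<open>x \<in> S\<close> by blast
  then show ?thesis
    using assms(1,2) unfolding strong_components_iff by blast
qed

end

section \<open>The search invariant and its first consequences\<close>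

text \<open>
  \<open>P\<close> is the path of tree arcs from the current vertex (its head) back to the root, that is, the
  vertices that have been previsited but not postvisited. The set \<open>T\<close> consists of the traversed
  arcs already accounted for in the sets; during the loop run on an arc it lacks that arc.
\<close>

locale search_invariant = fin_digraph G for G :: "('v, 'a) pre_digraph" +
  fixes s :: "('v, 'a) state" and P :: "'v list" and T :: "'a set"
  assumes current_eq: "current s = (if P = [] then None else Some (hd P))"
    and root_eq: "P \<noteq> [] \<Longrightarrow> search_root s = Some (last P)"
    and visited_verts: "visited s \<subseteq> verts G"
    and declared_visited: "\<Union>(declared s) \<subseteq> visited s"
    and path_live: "set P \<subseteq> visited s - \<Union>(declared s)"
    and path_sorted: "sorted_wrt (\<lambda>u v. pre s v < pre s u) P"
    and path_arcs: "successively (\<lambda>v u. \<exists>a \<in> tree_arcs s. tail G a = u \<and> head G a = v) P"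
    and tree_arcs_sub: "tree_arcs s \<subseteq> {a \<in> arcs G. head G a \<in> visited s}"
    and tree_arcs_inj: "inj_on (head G) (tree_arcs s)"
    and postvisited: "v \<in> visited s - set P \<Longrightarrow> exits G s v = {}"
    and pre_le_clock: "v \<in> visited s - \<Union>(declared s) \<Longrightarrow> pre s v \<le> enat (clock s)"
    and pre_declared: "v \<in> \<Union>(declared s) \<Longrightarrow> pre s v = \<infinity>"
    and leaders_path: "set (leaders s) \<subseteq> set P"
    and leaders_sorted: "sorted_wrt (\<lambda>u v. pre s v < pre s u) (leaders s)"
    and members_cover: "(\<Union>l \<in> set (leaders s). members s l) = visited s - \<Union>(declared s)"
    and leader_le: "l \<in> set (leaders s) \<Longrightarrow> w \<in> members s l \<Longrightarrow> pre s l \<le> pre s w"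
    and less_next_leader: "l \<in> set (leaders s) \<Longrightarrow> l' \<in> set (leaders s) \<Longrightarrow> pre s l < pre s l' \<Longrightarrow>
      w \<in> members s l \<Longrightarrow> pre s w < pre s l'"
    and members_connected: "l \<in> set (leaders s) \<Longrightarrow> x \<in> members s l \<Longrightarrow> y \<in> members s l \<Longrightarrow>
      x \<rightarrow>\<^sup>*\<^bsub>G\<^esub> y"
    and accounted_tail: "a \<in> T \<Longrightarrow> tail G a \<in> visited s"
    and accounted_head: "a \<in> T \<Longrightarrow> head G a \<in> visited s"
    and accounted: "a \<in> T \<Longrightarrow> l \<in> set (leaders s) \<Longrightarrow> tail G a \<in> members s l \<Longrightarrow>
      pre s l \<le> pre s (head G a)"
    and declared_closed: "a \<in> arcs G \<Longrightarrow> tail G a \<in> \<Union>(declared s) \<Longrightarrow> head G a \<in> \<Union>(declared s)"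
    and declared_sound: "declared s \<subseteq> strong_components G"
begin

lemma leaders_inj: "inj_on (pre s) (set (leaders s))"
  using inj_on_of_sorted_wrt[OF leaders_sorted] .

text \<open>Some leader's set contains \<open>l\<close>, as path vertices are undeclared. That
  leader cannot have a larger number than \<open>l\<close>, nor a smaller one:
  \<open>less_next_leader\<close> would then place \<open>l\<close> strictly below itself.\<close>

lemma leader_member:
  assumes "l \<in> set (leaders s)"
  shows "l \<in> members s l"
proof -
  from assms leaders_path path_live have "l \<in> visited s - \<Union>(declared s)" by blast
  then obtain l' where l': "l' \<in> set (leaders s)" "l \<in> members s l'"
    using members_cover by blast
  from leader_le[OF this] less_next_leader[OF l'(1) assms _ l'(2)] have "pre s l' = pre s l"
    by force
  with leaders_inj l' assms show ?thesis by (auto dest: inj_onD)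
qed

lemma members_disjoint:
  assumes "l \<in> set (leaders s)" "l' \<in> set (leaders s)" "l \<noteq> l'"
  shows "members s l \<inter> members s l' = {}"
proof -
  have "pre s l \<noteq> pre s l'" using leaders_inj assms by (auto dest: inj_onD)
  then show ?thesis
    using assms less_next_leader[of l l'] less_next_leader[of l' l] leader_le
    by (metis disjoint_iff leD neqE)
qed

lemma members_live: "l \<in> set (leaders s) \<Longrightarrow> members s l \<subseteq> visited s - \<Union>(declared s)"
  using members_cover by blast

text \<open>\<open>P\<close> runs from the current vertex back to the root, so its tree arcs point
  towards the front of the list, where the numbers are larger.\<close>

lemma path_reachable:
  assumes "u \<in> set P" "v \<in> set P" "pre s u \<le> pre s v"
  shows "u \<rightarrow>\<^sup>*\<^bsub>G\<^esub> v"
proof (cases "u = v")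
  case True
  then show ?thesis using assms path_live visited_verts by auto
next
  case False
  then have less: "pre s u < pre s v"
    using assms inj_on_of_sorted_wrt[OF path_sorted] by (metis inj_onD order_le_less)
  have "successively (\<lambda>v u. u \<rightarrow>\<^sup>*\<^bsub>G\<^esub> v) P"
    by (rule successively_mono[OF path_arcs])
      (use tree_arcs_sub arc_reachable in blast)
  moreover have "transp (\<lambda>v u. u \<rightarrow>\<^sup>*\<^bsub>G\<^esub> v)"
    by (rule transpI) (rule reachable_trans)
  ultimately have "sorted_wrt (\<lambda>v u. u \<rightarrow>\<^sup>*\<^bsub>G\<^esub> v) P"
    by (simp add: successively_conv_sorted_wrt)
  from sorted_wrt_by_key[OF this path_sorted assms(2,1) less] show ?thesis .
qed

lemma leaders_nonempty: "P \<noteq> [] \<Longrightarrow> leaders s \<noteq> []"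
  using members_cover path_live by (cases P) auto

section \<open>Preservation of the invariant\<close>

text \<open>One iteration of the loop. The sets of \<open>t\<close> and \<open>u\<close> belong
  together because of a closed walk through \<open>u\<close>, \<open>t\<close>, the current vertex,
  \<open>y\<close> and \<open>l\<close>, where \<open>l\<close> is the leader of the set of
  \<open>y\<close>: the path joins leaders to each other and to the current vertex, and
  \<open>a\<close> leads on to \<open>y\<close>.\<close>

lemma unite_top_invariant:
  assumes L: "leaders s = t # u # ts" and "y \<in> visited s" "pre s y < pre s t"
    and arc: "a \<in> arcs G" "tail G a = hd P" "head G a = y"
  shows "search_invariant G (s\<lparr>leaders := u # ts,
    members := (members s)(u := members s u \<union> members s t, t := {})\<rparr>) P T"
proof -
  have tu: "pre s u < pre s t" and uts: "\<And>l. l \<in> set ts \<Longrightarrow> pre s l < pre s u"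
    using leaders_sorted L by auto
  then have ne: "u \<noteq> t" "u \<notin> set ts" "t \<notin> set ts"
    using leaders_sorted L by auto
  have P: "t \<in> set P" "u \<in> set P" "hd P \<in> set P"
    using leaders_path L by (auto intro: hd_in_set)
  have max_path: "pre s v \<le> pre s (hd P)" if "v \<in> set P" for v
    using path_sorted that by (cases P) auto
  have ut: "u \<rightarrow>\<^sup>*\<^bsub>G\<^esub> t" using path_reachable P tu by auto
  have tu_reach: "t \<rightarrow>\<^sup>*\<^bsub>G\<^esub> u"
  proof -
    have "t \<rightarrow>\<^sup>*\<^bsub>G\<^esub> hd P" using path_reachable P max_path by auto
    also have "hd P \<rightarrow>\<^sup>*\<^bsub>G\<^esub> y" using arc_reachable arc by metis
    also have "y \<rightarrow>\<^sup>*\<^bsub>G\<^esub> u"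
    proof -
      \<comment> \<open>A number below another one is finite, whereas declared vertices carry
        infinity.\<close>
      have "y \<notin> \<Union>(declared s)" using pre_declared assms(3) by (metis enat_ord_simps(6))
      then obtain l where l: "l \<in> set (leaders s)" "y \<in> members s l"
        using assms(2) members_cover by blast
      \<comment> \<open>So \<open>l\<close> is not the top leader: it is \<open>u\<close> or lies
        deeper in the stack.\<close>
      have "pre s l < pre s t" using leader_le[OF l] assms(3) by simp
      then have lu: "pre s l \<le> pre s u" using l(1) L uts by (auto intro: less_imp_le)
      have "y \<rightarrow>\<^sup>*\<^bsub>G\<^esub> l" using members_connected l leader_member by blast
      also have "l \<rightarrow>\<^sup>*\<^bsub>G\<^esub> u" using path_reachable leaders_path l(1) P lu by blast
      finally show ?thesis .
    qed
    finally show ?thesis .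
  qed
  have top: "t \<in> set (leaders s)" "u \<in> set (leaders s)" using L by auto
  have to_u: "x \<rightarrow>\<^sup>*\<^bsub>G\<^esub> u" "u \<rightarrow>\<^sup>*\<^bsub>G\<^esub> x" if "x \<in> members s u \<union> members s t" for x
  proof -
    from that obtain l where l: "l \<in> {t, u}" "x \<in> members s l" by blast
    then have "x \<rightarrow>\<^sup>*\<^bsub>G\<^esub> l" "l \<rightarrow>\<^sup>*\<^bsub>G\<^esub> x"
      using members_connected[of l] leader_member[of l] top by auto
    moreover have "l \<rightarrow>\<^sup>*\<^bsub>G\<^esub> u" "u \<rightarrow>\<^sup>*\<^bsub>G\<^esub> l"
      using l(1) ut tu_reach reachable_in_verts(1)[OF ut] by auto
    ultimately show "x \<rightarrow>\<^sup>*\<^bsub>G\<^esub> u" "u \<rightarrow>\<^sup>*\<^bsub>G\<^esub> x" using reachable_trans by metis+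
  qed
  show ?thesis
  proof (unfold_locales, goal_cases)
    case 1 show ?case using current_eq by simp
  next
    case 2 then show ?case using root_eq by simp
  next
    case 3 show ?case using visited_verts by simp
  next
    case 4 show ?case using declared_visited by simp
  next
    case 5 show ?case using path_live by simp
  next
    case 6 show ?case using path_sorted by simp
  next
    case 7 show ?case using path_arcs by simp
  next
    case 8 show ?case using tree_arcs_sub by simp
  next
    case 9 show ?case using tree_arcs_inj by simp
  next
    case 10 then show ?case using postvisited by (simp add: exits_def)
  next
    case 11 then show ?case using pre_le_clock by simp
  next
    case 12 then show ?case using pre_declared by simp
  next
    case 13 show ?case using leaders_path L by simp
  next
    case 14 show ?case using leaders_sorted L by simp
  next
    case 15 show ?case using members_cover ne unfolding L by auto
  next
    case (16 l w)
    then show ?case using leader_le[of l w] leader_le[of t w] tu L ne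
      by (auto split: if_splits)
  next
    \<comment> \<open>The united set is on top now, so \<open>l\<close> cannot be \<open>u\<close>,
      and the sets further down are unchanged.\<close>
    case (17 l l' w)
    then show ?case using less_next_leader[of l l' w] uts L ne
      by (auto split: if_splits dest: less_asym)
  next
    case (18 l x y)
    then show ?case
      using members_connected[of l x y] reachable_trans[OF to_u(1)[of x] to_u(2)[of y]] L ne
      by (cases "l = u") (auto split: if_splits)
  next
    case (19 a) then show ?case using accounted_tail by simp
  next
    case (20 a) then show ?case using accounted_head by simp
  next
    \<comment> \<open>For a tail from the set of \<open>t\<close> the bound is inherited, since
      \<open>u\<close> has a smaller number than \<open>t\<close>.\<close>
    case (21 a l)
    then show ?case using accounted[of a l] accounted[of a t] tu L ne
      by (auto split: if_splits)
  next
    case (22 a) then show ?case using declared_closed by simp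
  next
    case 23 show ?case using declared_sound by simp
  qed
qed

text \<open>Both kinds of previsit at once: \<open>A\<close> is empty when a new search starts and
  holds the tree arc otherwise. The new number exceeds those of all undeclared visited vertices, so
  the singleton of \<open>v\<close> is a new topmost interval.\<close>

lemma previsit_invariant:
  assumes "v \<in> verts G" "v \<notin> visited s"
    and new: "P = [] \<and> A = {} \<and> r = Some v \<or>
      P \<noteq> [] \<and> (\<exists>a \<in> arcs G. A = {a} \<and> tail G a = hd P \<and> head G a = v) \<and> r = search_root s"
  shows "search_invariant G (previsit v (s\<lparr>traversed := A \<union> traversed s,
    tree_arcs := A \<union> tree_arcs s, current := Some v, search_root := r\<rparr>)) (v # P) (A \<union> T)"
proof -
  have less: "pre s w < enat (Suc (clock s))" if "w \<in> visited s - \<Union>(declared s)" for w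
    using pre_le_clock[OF that] by (metis enat_ord_simps(2) lessI order_le_less_trans)
  have P: "v \<notin> set P" "v \<notin> set (leaders s)" "v \<notin> \<Union>(declared s)"
    using path_live leaders_path declared_visited assms(2) by auto
  have L: "l \<noteq> v" "pre s l < enat (Suc (clock s))" if "l \<in> set (leaders s)" for l
    using that P less leaders_path path_live by blast+
  have M: "w \<noteq> v" "pre s w < enat (Suc (clock s))" if "l \<in> set (leaders s)" "w \<in> members s l" for l w
    using members_live[OF that(1)] that less assms(2) by auto
  \<comment> \<open>No tree arc enters an unvisited vertex, which keeps the heads of tree arcs
    distinct.\<close>
  have no_tree: "a \<in> tree_arcs s \<Longrightarrow> head G a \<noteq> v" for a
    using tree_arcs_sub assms(2) by auto
  have A: "tail G a \<in> set P" "head G a = v" "a \<in> arcs G" if "a \<in> A" for a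
    using new that by auto
  show ?thesis
  proof (unfold_locales, goal_cases)
    case 1 show ?case by (simp add: previsit_def)
  next
    case 2 show ?case using new root_eq by (auto simp: previsit_def)
  next
    case 3 show ?case using visited_verts assms(1) by (simp add: previsit_def)
  next
    case 4 show ?case using declared_visited by (auto simp: previsit_def)
  next
    case 5 show ?case using path_live P by (auto simp: previsit_def)
  next
    case 6
    have "sorted_wrt (\<lambda>x y. ((pre s)(v := enat (Suc (clock s)))) y <
        ((pre s)(v := enat (Suc (clock s)))) x) P"
      by (rule sorted_wrt_mono_rel[OF _ path_sorted]) (use P in auto)
    then show ?case using P less path_live by (auto simp: previsit_def)
  next
    case 7
    have "successively (\<lambda>v u. \<exists>a \<in> A \<union> tree_arcs s. tail G a = u \<and> head G a = v) P"
      by (rule successively_mono[OF path_arcs]) auto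
    then show ?case using new by (auto simp: previsit_def successively_Cons)
  next
    case 8 show ?case using tree_arcs_sub A by (auto simp: previsit_def)
  next
    case 9
    have "inj_on (head G) A" using new by auto
    then show ?case using tree_arcs_inj no_tree A by (auto simp: previsit_def inj_on_Un)
  next
    case (10 w) then show ?case using postvisited[of w] by (auto simp: previsit_def exits_def)
  next
    case (11 w) then show ?case using less[of w] by (auto simp: previsit_def intro: less_imp_le)
  next
    case (12 w) then show ?case using pre_declared[of w] P by (auto simp: previsit_def)
  next
    case 13 show ?case using leaders_path by (auto simp: previsit_def)
  next
    case 14
    have "sorted_wrt (\<lambda>x y. ((pre s)(v := enat (Suc (clock s)))) y <
        ((pre s)(v := enat (Suc (clock s)))) x) (leaders s)"
      by (rule sorted_wrt_mono_rel[OF _ leaders_sorted]) (use P in auto)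
    then show ?case using L by (auto simp: previsit_def)
  next
    case 15
    have "(\<Union>l \<in> set (leaders s). ((members s)(v := {v})) l) = (\<Union>l \<in> set (leaders s). members s l)"
      using L by (intro SUP_cong) auto
    then show ?case using members_cover P by (auto simp: previsit_def)
  next
    case (16 l w)
    then show ?case using leader_le[of l w] L[of l] M[of l w]
      by (cases "l = v") (auto simp: previsit_def)
  next
    case (17 l l' w)
    then show ?case using less_next_leader[of l l' w] L[of l] L[of l'] M[of l w]
      by (cases "l = v"; cases "l' = v") (auto simp: previsit_def dest: less_asym)
  next
    case (18 l x y)
    then show ?case using members_connected[of l x y] assms(1)
      by (cases "l = v") (auto simp: previsit_def)
  next
    case (19 a) then show ?case using accounted_tail[of a] A[of a] path_live by (auto simp: previsit_def)
  next
    case (20 a) then show ?case using accounted_head[of a] A[of a] by (auto simp: previsit_def)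
  next
    case (21 a l)
    \<comment> \<open>A new arc leads to \<open>v\<close>, whose number is the largest among the
      leaders; an old accounted arc had both ends visited before, so the new number does not touch
      it.\<close>
    show ?case
    proof (cases "a \<in> A")
      case True
      then show ?thesis using A[of a] 21 L[of l]
        by (cases "l = v") (auto simp: previsit_def intro: less_imp_le)
    next
      case False
      with 21 have a: "a \<in> T" by simp
      then have "l \<noteq> v" "head G a \<noteq> v"
        using 21 accounted_tail[of a] accounted_head[of a] assms(2) by (auto simp: previsit_def)
      then show ?thesis using accounted[OF a, of l] 21 by (auto simp: previsit_def)
    qed
  next
    case (22 a) then show ?case using declared_closed by (simp add: previsit_def)
  next
    case 23 show ?case using declared_sound by (simp add: previsit_def)
  qed
qed

text \<open>Shared by the changes that leave numbers and sets alone: postvisited vertices that lead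
  no set leave the front of the path, traversed arcs are added, and arcs whose heads respect every
  leader become accounted for.\<close>

lemma invariant_if_same_sets:
  assumes same: "visited s' = visited s" "tree_arcs s' = tree_arcs s" "clock s' = clock s"
      "pre s' = pre s" "members s' = members s" "leaders s' = leaders s" "declared s' = declared s"
    and trav: "traversed s \<subseteq> traversed s'"
    and cur: "current s' = (if P' = [] then None else Some (hd P'))"
    and root: "P' \<noteq> [] \<Longrightarrow> search_root s' = Some (last P')"
    and P: "P = Q @ P'" "set (leaders s) \<subseteq> set P'" "\<And>v. v \<in> set Q \<Longrightarrow> exits G s v = {}"
    and T': "\<And>a. a \<in> T' - T \<Longrightarrow> tail G a \<in> visited s \<and> head G a \<in> visited s \<and>
      (\<forall>l \<in> set (leaders s). pre s l \<le> pre s (head G a))"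
  shows "search_invariant G s' P' T'"
proof (unfold_locales, goal_cases)
  case 1 show ?case using cur .
next
  case 2 then show ?case using root by simp
next
  case 3 show ?case using visited_verts same by simp
next
  case 4 show ?case using declared_visited same by simp
next
  case 5 show ?case using path_live P same by simp
next
  case 6 show ?case using path_sorted P same by (simp add: sorted_wrt_append)
next
  case 7 show ?case using path_arcs P same by (simp add: successively_append_iff)
next
  case 8 show ?case using tree_arcs_sub same by simp
next
  case 9 show ?case using tree_arcs_inj same by simp
next
  case (10 w)
  have "exits G s' w \<subseteq> exits G s w" using trav by (auto simp: exits_def)
  then show ?case using postvisited[of w] P(1) P(3)[of w] 10 same by auto
next
  case 11 then show ?case using pre_le_clock same by simp
next
  case 12 then show ?case using pre_declared same by simp
next
  case 13 show ?case using P same by simp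
next
  case 14 show ?case using leaders_sorted same by simp
next
  case 15 show ?case using members_cover same by simp
next
  case 16 then show ?case using leader_le same by simp
next
  case 17 then show ?case using less_next_leader same by simp
next
  case 18 then show ?case using members_connected same by simp
next
  case (19 a) then show ?case using accounted_tail[of a] T'[of a] same by auto
next
  case (20 a) then show ?case using accounted_head[of a] T'[of a] same by auto
next
  case (21 a l) then show ?case using accounted[of a l] T'[of a] same by auto
next
  case 22 then show ?case using declared_closed same by simp
next
  case 23 show ?case using declared_sound same by simp
qed

text \<open>If \<open>v\<close> is not on top, it leads no set and only the path shrinks. If it is,
  its set is closed up to declared vertices, since \<open>T = traversed s\<close> makes every
  traversed arc accounted for.\<close>

lemma postvisit_invariant:
  assumes P: "P = v # P'" and T: "T = traversed s" and ex: "exits G s v = {}"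
  shows "search_invariant G
    ((postvisit v s)\<lparr>current := if P' = [] then None else Some (hd P')\<rparr>) P' T"
proof (cases "hd (leaders s) = v")
  case False
  then have s': "postvisit v s = s" by (simp add: postvisit_def)
  \<comment> \<open>The front of the path has the largest number on it, so as a leader
    \<open>v\<close> would be on top.\<close>
  have "v \<notin> set (leaders s)"
  proof
    assume v: "v \<in> set (leaders s)"
    then obtain t ts where L: "leaders s = t # ts" by (cases "leaders s") auto
    with v False leaders_sorted have "pre s v < pre s t" by auto
    moreover have "t \<in> set P" using L leaders_path by auto
    ultimately show False using path_sorted P by auto
  qed
  then have lead: "set (leaders s) \<subseteq> set P'" using leaders_path P by auto
  show ?thesis unfolding s'
    by (rule invariant_if_same_sets[of _ _ "[v]"]) (use P root_eq lead ex in simp_all)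
next
  case True
  then obtain ls where L: "leaders s = v # ls"
    using leaders_nonempty P by (cases "leaders s") auto
  let ?S = "members s v" and ?D = "\<Union>(declared s)"
  have s': "postvisit v s = s\<lparr>leaders := ls, pre := (\<lambda>w. if w \<in> ?S then \<infinity> else pre s w),
      declared := insert ?S (declared s)\<rparr>"
    using L by (simp add: postvisit_def)
  have v: "v \<in> set (leaders s)" using L by simp
  have S: "?S \<subseteq> visited s - ?D" using members_live[OF v] .
  \<comment> \<open>The rest of the path is numbered below \<open>v\<close>; so apart from
    \<open>v\<close> all members of its set have been postvisited.\<close>
  have path: "w \<notin> ?S" if "w \<in> set P'" for w
    using path_sorted P that leader_le[OF v, of w] by auto
  have ls: "l \<notin> ?S" "members s l \<inter> ?S = {}" "l \<in> set P'" if "l \<in> set ls" for l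
  proof -
    have l: "l \<in> set (leaders s)" "l \<noteq> v"
      using that L distinct_of_sorted_wrt[OF leaders_sorted] by auto
    then show "l \<in> set P'" using leaders_path P by auto
    show "members s l \<inter> ?S = {}" using members_disjoint[OF l(1) v l(2)] .
    then show "l \<notin> ?S" using leader_member[OF l(1)] by blast
  qed
  \<comment> \<open>The interval of the top leader has no upper bound: it takes in every undeclared
    visited vertex numbered from \<open>v\<close> on.\<close>
  have in_S: "w \<in> ?S" if w: "w \<in> visited s - ?D" and vw: "pre s v \<le> pre s w" for w
  proof -
    have "w \<in> (\<Union>l \<in> set (leaders s). members s l)" unfolding members_cover by (rule w)
    then obtain l where l: "l \<in> set (leaders s)" "w \<in> members s l" by blast
    have "\<not> pre s l < pre s v" using less_next_leader[OF l(1) v _ l(2)] vw by auto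
    then have "l = v" using l(1) L leaders_sorted by auto
    with l show ?thesis by simp
  qed
  \<comment> \<open>All exits of the tail are traversed, so the head is not numbered below
    \<open>v\<close>: it lies in \<open>?S\<close> unless it has been declared.\<close>
  have S_closed: "head G a \<in> ?S \<union> ?D" if a: "a \<in> arcs G" "tail G a \<in> ?S" for a
  proof -
    have "exits G s (tail G a) = {}"
      using postvisited[of "tail G a"] path[of "tail G a"] S a P ex by auto
    then have "a \<in> T" using a T by (auto simp: exits_def)
    from accounted[OF this v a(2)] accounted_head[OF this] in_S show ?thesis by blast
  qed
  have S_comp: "?S \<in> strong_components G"
    by (rule strong_component_if_closed[of v _ ?D])
      (use leader_member[OF v] S visited_verts members_connected[OF v] declared_closed S_closed
        in auto)
  show ?thesis unfolding s'
  proof (unfold_locales, goal_cases)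
    case 1 show ?case by simp
  next
    case 2 then show ?case using root_eq P by simp
  next
    case 3 show ?case using visited_verts by simp
  next
    case 4 show ?case using declared_visited S by auto
  next
    case 5 show ?case using path_live P path by auto
  next
    case 6
    have "sorted_wrt (\<lambda>u v. pre s v < pre s u) P'" using path_sorted P by simp
    from sorted_wrt_mono_rel[OF _ this] path show ?case by simp
  next
    case 7 show ?case using path_arcs P by (auto simp: successively_Cons)
  next
    case 8 show ?case using tree_arcs_sub by simp
  next
    case 9 show ?case using tree_arcs_inj by simp
  next
    case (10 w) then show ?case using postvisited[of w] ex P by (auto simp: exits_def)
  next
    case 11 then show ?case using pre_le_clock by simp
  next
    case (12 w) then show ?case using pre_declared[of w] by auto
  next
    case 13 show ?case using ls by auto
  next
    case 14
    have "sorted_wrt (\<lambda>u v. pre s v < pre s u) ls" using leaders_sorted L by simp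
    from sorted_wrt_mono_rel[OF _ this] ls(1) show ?case by simp
  next
    case 15
    have "(\<Union>l \<in> set ls. members s l) = visited s - ?D - ?S"
      using members_cover ls(2) unfolding L by auto
    then show ?case by auto
  next
    case (16 l w) then show ?case using leader_le[of l w] ls(1)[of l] L by simp
  next
    case (17 l l' w)
    then show ?case using less_next_leader[of l l' w] ls(1,2)[of l] ls(1)[of l'] L by auto
  next
    case (18 l x y) then show ?case using members_connected[of l x y] L by simp
  next
    case 19 then show ?case using accounted_tail by simp
  next
    case 20 then show ?case using accounted_head by simp
  next
    \<comment> \<open>Heads in \<open>?S\<close> jump to infinity, which only helps the bound;
      leaders left on the stack keep their numbers.\<close>
    case (21 a l) then show ?case using accounted[of a l] ls(1)[of l] L by simp
  next
    case (22 a) then show ?case using declared_closed[of a] S_closed[of a] by auto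
  next
    case 23 show ?case using declared_sound S_comp by simp
  qed
qed

text \<open>Once the loop has ended, no leader is numbered above the head, so the condition on
  accounted arcs holds whichever set contains the tail.\<close>

lemma account_arc_invariant:
  assumes "tail G a \<in> visited s" "head G a \<in> visited s"
    and "\<And>l. l \<in> set (leaders s) \<Longrightarrow> pre s l \<le> pre s (head G a)"
  shows "search_invariant G s P (insert a T)"
proof (rule invariant_if_same_sets[of _ _ "[]"])
  fix b assume "b \<in> insert a T - T"
  then have "b = a" by blast
  then show "tail G b \<in> visited s \<and> head G b \<in> visited s \<and>
      (\<forall>l \<in> set (leaders s). pre s l \<le> pre s (head G b))"
    using assms by simp
qed (use current_eq root_eq leaders_path in simp_all)

text \<open>The arc is not added to \<open>T\<close> before the loop runs, because its head may
  still lie below the set of its tail.\<close>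

lemma advance_invariant: "search_invariant G (s\<lparr>traversed := insert a (traversed s)\<rparr>) P T"
  by (rule invariant_if_same_sets[of _ _ "[]"]) (use current_eq root_eq leaders_path in \<open>simp_all add: subset_insertI\<close>)

end

section \<open>The loop on a non-tree arc\<close>

text \<open>Uniting does not change numbers, so the bound remains the number of \<open>y\<close>; at
  exit the top leader respects it, and so do the leaders further down, whose numbers are
  smaller.\<close>

lemma unite_loop_invariant:
  assumes "unite_loop k s s'" "search_invariant G s P T" "k = pre s y" "y \<in> visited s"
    and "a \<in> arcs G" "tail G a = hd P" "head G a = y"
  shows "search_invariant G s' P T \<and> traversed s' = traversed s \<and> visited s' = visited s \<and>
    (\<forall>l \<in> set (leaders s'). pre s' l \<le> pre s' y)"
  using assms
proof (induction rule: unite_loop.induct)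
  case (exit s t ts)
  then interpret search_invariant G s P T by simp
  show ?case using exit leaders_sorted by (auto simp: not_less)
next
  case (iterate s t u ts s')
  then interpret search_invariant G s P T by simp
  from unite_top_invariant[OF iterate(1) _ _ iterate(8,9,10)] iterate show ?case by simp
qed

text \<open>The loop cannot run out of leaders: if the top \<open>t\<close> exceeds the number of
  \<open>y\<close>, then \<open>y\<close> is undeclared and in the set of another leader, which is
  on the stack below \<open>t\<close>. Each iteration shortens the stack.\<close>

lemma unite_loop_exists:
  assumes "search_invariant G s P T" "y \<in> visited s" "P \<noteq> []"
    and "a \<in> arcs G" "tail G a = hd P" "head G a = y"
  shows "\<exists>s'. unite_loop (pre s y) s s'"
  using assms
proof (induction "length (leaders s)" arbitrary: s rule: less_induct)
  case less
  interpret search_invariant G s P T by (rule less.prems(1))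
  obtain t ts where L: "leaders s = t # ts"
    using leaders_nonempty[OF less.prems(3)] by (cases "leaders s") auto
  show ?case
  proof (cases "pre s t > pre s y")
    case False
    then show ?thesis using unite_loop.exit[OF L] by (intro exI)
  next
    case True
    then have "y \<notin> \<Union>(declared s)" using pre_declared by (metis enat_ord_simps(6))
    then obtain l where l: "l \<in> set (leaders s)" "y \<in> members s l"
      using less.prems(2) members_cover by blast
    then have "l \<noteq> t" using leader_le True by (metis leD)
    then obtain u us where ts: "ts = u # us" using l L by (cases ts) auto
    let ?s = "s\<lparr>leaders := u # us,
      members := (members s)(u := members s u \<union> members s t, t := {})\<rparr>"
    have "search_invariant G ?s P T"
      using unite_top_invariant[OF _ less.prems(2) True less.prems(4-6)] L ts by blast
    from less.hyps[OF _ this _ less.prems(3-6)] less.prems(2) L ts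
    obtain s' where "unite_loop (pre s y) ?s s'" by auto
    from unite_loop.iterate[OF _ True this] L ts show ?thesis by blast
  qed
qed

section \<open>Single steps and termination\<close>

text \<open>An unvisited vertex weighs 2 because starting a new search lengthens the path by one
  without traversing an arc.\<close>

definition search_measure :: "('v, 'a) pre_digraph \<Rightarrow> ('v, 'a) state \<Rightarrow> 'v list \<Rightarrow> nat" where
  "search_measure G s P =
     2 * card (verts G - visited s) + card (arcs G - traversed s) + length P"

lemma (in fin_digraph) init_invariant: "search_invariant G init [] (traversed init)"
  by unfold_locales (auto simp: init_def)

text \<open>Between steps all traversed arcs are accounted for, hence \<open>T\<close> is
  \<open>traversed s\<close>.\<close>

lemma step_invariant:
  assumes "search_invariant G s P (traversed s)" "step G s s'"
  shows "\<exists>P'. search_invariant G s' P' (traversed s') \<and> search_measure G s' P' < search_measure G s P"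
proof -
  interpret search_invariant G s P "traversed s" by fact
  have fewer_verts: "card (verts G - insert v (visited s)) < card (verts G - visited s)"
    if "v \<in> verts G" "v \<notin> visited s" for v
    using that by (intro psubset_card_mono) auto
  have fewer_arcs: "card (arcs G - insert a (traversed s)) < card (arcs G - traversed s)"
    if "a \<in> exits G s v" for a v
    using that by (intro psubset_card_mono) (auto simp: exits_def)
  have path: "\<exists>P'. P = v # P'" if "current s = Some v" for v
    using that current_eq by (cases P) auto
  from assms(2) show ?thesis
  proof cases
    case (new_search v)
    then have P: "P = []" using current_eq by (auto split: if_splits)
    have "s' = previsit v (s\<lparr>traversed := {} \<union> traversed s, tree_arcs := {} \<union> tree_arcs s,
        current := Some v, search_root := Some v\<rparr>)"
      using new_search by simp
    with previsit_invariant[of v "{}" "Some v"] new_search P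
    have "search_invariant G s' [v] (traversed s')" by (simp add: previsit_def)
    moreover have "search_measure G s' [v] < search_measure G s P"
      using fewer_verts[of v] new_search P by (simp add: search_measure_def previsit_def)
    ultimately show ?thesis by blast
  next
    case (nontree_arc v a)
    obtain P' where P: "P = v # P'" using path nontree_arc by blast
    have a: "a \<in> arcs G" "tail G a = hd P" "hd P \<in> visited s"
      using nontree_arc P path_live by (auto simp: exits_def)
    \<comment> \<open>The loop is entered with \<open>a\<close> traversed but not yet added to
      \<open>T\<close>; its exit condition then allows \<open>a\<close> to be added.\<close>
    have inv: "search_invariant G s' P (traversed s)" and s': "traversed s' = insert a (traversed s)"
      "visited s' = visited s" "\<forall>l \<in> set (leaders s'). pre s' l \<le> pre s' (head G a)"
      using unite_loop_invariant[OF nontree_arc(4) advance_invariant _ _ a(1,2) refl] nontree_arc(3)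
      by simp_all
    have "search_invariant G s' P (traversed s')"
      unfolding s'(1) by (rule search_invariant.account_arc_invariant[OF inv])
        (use s' a nontree_arc in auto)
    moreover have "search_measure G s' P < search_measure G s P"
      using fewer_arcs[of a v] nontree_arc s' by (simp add: search_measure_def)
    ultimately show ?thesis by blast
  next
    case (tree_arc v a)
    have a: "a \<in> arcs G" "tail G a = hd P" "P \<noteq> []"
      using tree_arc path[OF tree_arc(2)] by (auto simp: exits_def)
    have "s' = previsit (head G a) (s\<lparr>traversed := {a} \<union> traversed s,
        tree_arcs := {a} \<union> tree_arcs s, current := Some (head G a), search_root := search_root s\<rparr>)"
      using tree_arc by simp
    with previsit_invariant[of "head G a" "{a}" "search_root s"] tree_arc a
    have "search_invariant G s' (head G a # P) (traversed s')" by (simp add: previsit_def)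
    moreover have "search_measure G s' (head G a # P) < search_measure G s P"
      using fewer_arcs[of a v] fewer_verts[of "head G a"] tree_arc a
      by (simp add: search_measure_def previsit_def)
    ultimately show ?thesis by blast
  next
    case (finish_search v)
    obtain P' where P: "P = v # P'" using path finish_search by blast
    \<comment> \<open>\<open>v\<close> is both first and last in a path without repetitions.\<close>
    have "v = last P" using root_eq P finish_search by simp
    then have "P' = []"
      using distinct_of_sorted_wrt[OF path_sorted] P by (auto split: if_splits)
    then have "search_invariant G s' (P') (traversed s)"
      using postvisit_invariant[OF P refl] finish_search by simp
    moreover have "traversed s' = traversed s" "visited s' = visited s"
      using finish_search by (simp_all add: postvisit_def)
    moreover have "length (P') < length P" using P by simp
    ultimately show ?thesis by (auto simp: search_measure_def)
  next
    case (retreat v a)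
    obtain P' where P: "P = v # P'" using path retreat by blast
    have "P' \<noteq> []" using P root_eq retreat by auto
    then obtain u us where us: "P' = u # us" by (cases "P'") auto
    with path_arcs P obtain b where "b \<in> tree_arcs s" "tail G b = u" "head G b = v"
      by auto
    \<comment> \<open>The rule admits any tree arc entering \<open>v\<close>; distinct heads force
      it to be the one from the next path vertex.\<close>
    then have "tail G a = u" using tree_arcs_inj retreat by (auto dest: inj_onD)
    then have "search_invariant G s' (P') (traversed s)"
      using postvisit_invariant[OF P refl] retreat us by simp
    moreover have "traversed s' = traversed s" "visited s' = visited s"
      using retreat by (simp_all add: postvisit_def)
    moreover have "length (P') < length P" using P by simp
    ultimately show ?thesis by (auto simp: search_measure_def)
  qed
qed

text \<open>A nonempty path always admits a step: for a retreat the path itself supplies the tree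
  arc, and for a non-tree arc the loop is known to end.\<close>

lemma stuck_all_declared:
  assumes "search_invariant G s P (traversed s)" "\<nexists>s'. step G s s'"
  shows "\<Union>(declared s) = verts G"
proof -
  interpret search_invariant G s P "traversed s" by fact
  have P: "P = []"
  proof (rule ccontr)
    assume "P \<noteq> []"
    then obtain v P' where P: "P = v # P'" by (cases P) auto
    then have cur: "current s = Some v" using current_eq by simp
    show False
    proof (cases "exits G s v = {}")
      case True
      show False
      proof (cases "search_root s = Some v")
        case False
        then obtain u us where us: "P' = u # us" using root_eq P by (cases P') auto
        with path_arcs P obtain b where "b \<in> tree_arcs s" "head G b = v" by auto
        with step.retreat[OF cur True False] assms(2) show False by blast
      qed (use step.finish_search[OF cur True] assms(2) in blast)
    next
      case False
      then obtain a where a: "a \<in> exits G s v" by blast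
      show False
      proof (cases "head G a \<in> visited s")
        case True
        have "\<exists>s'. unite_loop (pre s (head G a)) (s\<lparr>traversed := insert a (traversed s)\<rparr>) s'"
          using unite_loop_exists[OF advance_invariant, of "head G a" a a] a P True
          by (simp add: exits_def)
        with step.nontree_arc[OF cur a True] assms(2) show False by blast
      qed (use step.tree_arc[OF cur a] assms(2) in blast)
    qed
  qed
  then have "visited s = verts G"
    using step.new_search[of s _ G] assms(2) current_eq visited_verts by auto
  \<comment> \<open>An empty path leaves no leaders, so the sets cover nothing and every visited
    vertex is declared.\<close>
  then show ?thesis using P leaders_path members_cover declared_visited by auto
qed

section \<open>Correctness of complete runs\<close>

theorem theorem3:
  fixes G :: "('v, 'a) pre_digraph" and \<sigma> :: "nat \<Rightarrow> ('v, 'a) state"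
  assumes "fin_digraph G"
    and "algorithm_C_run G \<sigma>"
  shows "declared_sets \<sigma> = strong_components G"
proof -
  interpret fin_digraph G by fact
  have start: "\<sigma> 0 = init"
    and run: "\<And>n. step G (\<sigma> n) (\<sigma> (Suc n)) \<or> (\<nexists>s'. step G (\<sigma> n) s') \<and> \<sigma> (Suc n) = \<sigma> n"
    using assms(2) unfolding algorithm_C_run_def by auto
  have inv: "\<exists>P. search_invariant G (\<sigma> n) P (traversed (\<sigma> n))" for n
  proof (induction n)
    case 0
    then show ?case using start init_invariant by auto
  next
    case (Suc n)
    then show ?case using run[of n] step_invariant by metis
  qed
  \<comment> \<open>As long as the run moves, the measure of the next state is smaller, so a state
    without successor is reached.\<close>
  have stuck: "\<exists>m. \<nexists>s'. step G (\<sigma> m) s'" if "search_invariant G (\<sigma> n) P (traversed (\<sigma> n))" for n P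
    using that
  proof (induction "search_measure G (\<sigma> n) P" arbitrary: n P rule: less_induct)
    case less
    then show ?case using run[of n] step_invariant by metis
  qed
  then obtain m where m: "\<nexists>s'. step G (\<sigma> m) s'" using inv[of 0] by blast
  have cover: "\<Union>(declared (\<sigma> m)) = verts G"
    using stuck_all_declared inv m by blast
  have sound: "declared (\<sigma> n) \<subseteq> strong_components G" for n
    using inv search_invariant.declared_sound by blast
  \<comment> \<open>Some set declared by time \<open>m\<close> contains a vertex of
    \<open>C\<close>; it is itself a strong component, and two of those sharing a vertex
    coincide.\<close>
  have "C \<in> declared (\<sigma> m)" if C: "C \<in> strong_components G" for C
  proof -
    from C obtain x where x: "x \<in> verts G" "C = {y. x \<rightarrow>\<^sup>*\<^bsub>G\<^esub> y \<and> y \<rightarrow>\<^sup>*\<^bsub>G\<^esub> x}"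
      unfolding strong_components_iff by blast
    with cover obtain C' where C': "C' \<in> declared (\<sigma> m)" "x \<in> C'" by blast
    then obtain x' where "C' = {y. x' \<rightarrow>\<^sup>*\<^bsub>G\<^esub> y \<and> y \<rightarrow>\<^sup>*\<^bsub>G\<^esub> x'}"
      using sound[of m] strong_components_iff by blast
    with x C' have "C = C'" by (auto intro: reachable_trans)
    with C' show ?thesis by simp
  qed
  with sound show ?thesis unfolding declared_sets_def by blast
qed

end
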